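(* Let $X(t)$, $t\ge0$, be a continuous time irreducible Markov chain on $I=\{1,2,\ldots,n\}$ which is reversible with respect to the uniform distribution on $I$, started in an initial state $a\in I$. Then, for all $t\ge0$, $$H(P^a_{2t})-H(P^a_t)=H(P^a_{t,2t}\,|\,P^a_{3t,2t}).$$ In particular, the inequality $$\|P^a_t-P^a_{3t}\|_{TV}\leq\sqrt{2\big(H(P^a_{2t})-H(P^a_t)\big)}$$ holds for all $t\ge0$ and all initial states $a\in I$.
   Context: For $t\ge0$, $P^a_t$ denotes the distribution of $X(t)$ when $X(0)=a$, and for $u,s\ge0$, $P^a_{u,s}$ denotes the law on $I^2$ of the random vector $(X(u),X(s))$ when $X(0)=a$ (so $P^a_{3t,2t}$ is the law of $(X(3t),X(2t))$ in this order). The entropy of a probability measure $p$ on a finite set is $H(p)=-\sum_i p(i)\log p(i)$ with $0\log0=0$, and the relative entropy of probability measures $p,q$ is $H(p|q)=\sum_i p(i)\log\frac{p(i)}{q(i)}$ (terms with $p(i)=0$ are zero). The total variation norm of a signed measure $\pi$ on $I$ is $\|\pi\|_{TV}=\sum_{i\in I}|\pi(i)|$. *)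

theory Defs
  imports "HOL-Probability.Probability"
begin

text \<open>Standard transition functions on a finite state space \<open>I\<close>; \<open>p t i j\<close> is the
  probability of a transition from \<open>i\<close> to \<open>j\<close> in time \<open>t\<close>.\<close>

locale transition_function =
  fixes I :: "'s set" and p :: "real \<Rightarrow> 's \<Rightarrow> 's \<Rightarrow> real"
  assumes finite_states: "finite I"
    and nonneg: "\<And>t i j. 0 \<le> t \<Longrightarrow> i \<in> I \<Longrightarrow> j \<in> I \<Longrightarrow> 0 \<le> p t i j"
    and row_sum: "\<And>t i. 0 \<le> t \<Longrightarrow> i \<in> I \<Longrightarrow> (\<Sum>j\<in>I. p t i j) = 1"
    and at_zero: "\<And>i j. i \<in> I \<Longrightarrow> j \<in> I \<Longrightarrow> p 0 i j = (if i = j then 1 else 0)"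
    and chapman_kolmogorov:
      "\<And>s t i j. 0 \<le> s \<Longrightarrow> 0 \<le> t \<Longrightarrow> i \<in> I \<Longrightarrow> j \<in> I \<Longrightarrow>
        p (s + t) i j = (\<Sum>k\<in>I. p s i k * p t k j)"
    and continuous_at_zero: "\<And>i. i \<in> I \<Longrightarrow> ((\<lambda>t. p t i i) \<longlongrightarrow> 1) (at_right 0)"

text \<open>Time-homogeneous Markov chains in continuous time. The times \<open>ts 0 \<le> \<dots> \<le> ts m\<close>
  form an arbitrary finite part of the past of \<open>t\<close>, the last one being the present;
  no regularity of the sample paths is required.\<close>

locale markov_chain = prob_space M + transition_function I p
  for M :: "'w measure" and I :: "'s set" and p :: "real \<Rightarrow> 's \<Rightarrow> 's \<Rightarrow> real" +
  fixes X :: "real \<Rightarrow> 'w \<Rightarrow> 's"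
  assumes measurable_states: "\<And>t. 0 \<le> t \<Longrightarrow> X t \<in> M \<rightarrow>\<^sub>M count_space I"
    and markov:
      "\<And>(ts :: nat \<Rightarrow> real) (xs :: nat \<Rightarrow> 's) m t j.
        0 \<le> ts 0 \<Longrightarrow> mono_on {..m} ts \<Longrightarrow> ts m \<le> t \<Longrightarrow>
        (\<And>k. k \<le> m \<Longrightarrow> xs k \<in> I) \<Longrightarrow> j \<in> I \<Longrightarrow>
        \<P>(\<omega> in M. \<forall>k\<le>m. X (ts k) \<omega> = xs k) > 0 \<Longrightarrow>
        \<P>(\<omega> in M. X t \<omega> = j \<bar> \<forall>k\<le>m. X (ts k) \<omega> = xs k) = p (t - ts m) (xs m) j"

definition irreducible_chain :: "'s set \<Rightarrow> (real \<Rightarrow> 's \<Rightarrow> 's \<Rightarrow> real) \<Rightarrow> bool" where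
  "irreducible_chain I p \<longleftrightarrow> (\<forall>i\<in>I. \<forall>j\<in>I. \<exists>t\<ge>0. p t i j > 0)"

definition reversible_wrt :: "'s set \<Rightarrow> (real \<Rightarrow> 's \<Rightarrow> 's \<Rightarrow> real) \<Rightarrow> 's pmf \<Rightarrow> bool" where
  "reversible_wrt I p \<pi> \<longleftrightarrow>
    (\<forall>t\<ge>0. \<forall>i\<in>I. \<forall>j\<in>I. pmf \<pi> i * p t i j = pmf \<pi> j * p t j i)"

definition law :: "'w measure \<Rightarrow> 's set \<Rightarrow> (real \<Rightarrow> 'w \<Rightarrow> 's) \<Rightarrow> real \<Rightarrow> 's measure" where
  "law M I X t = distr M (count_space I) (X t)"

definition joint_law ::
    "'w measure \<Rightarrow> 's set \<Rightarrow> (real \<Rightarrow> 'w \<Rightarrow> 's) \<Rightarrow> real \<Rightarrow> real \<Rightarrow> ('s \<times> 's) measure" where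
  "joint_law M I X u s = distr M (count_space (I \<times> I)) (\<lambda>\<omega>. (X u \<omega>, X s \<omega>))"

text \<open>The functionals below are meant for measures on finite spaces in which all subsets
  are measurable. The convention \<open>0 log 0 = 0\<close> is automatic for \<open>shannon_entropy\<close>.\<close>

definition shannon_entropy :: "'s measure \<Rightarrow> real" where
  "shannon_entropy P = - (\<Sum>i\<in>space P. measure P {i} * ln (measure P {i}))"

text \<open>Extended-real valued: a point charged by \<open>P\<close> but not by \<open>Q\<close> contributes \<open>\<infinity>\<close>,
  whereas \<open>x * ln (x / 0)\<close> would be \<open>0\<close>.\<close>

definition relative_entropy :: "'s measure \<Rightarrow> 's measure \<Rightarrow> ereal" where
  "relative_entropy P Q =
    (\<Sum>i\<in>space P.
      if measure P {i} = 0 then 0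
      else if measure Q {i} = 0 then \<infinity>
      else ereal (measure P {i} * ln (measure P {i} / measure Q {i})))"

text \<open>A signed measure on a finite set is given by its point masses. The norm carries no
  factor \<open>1/2\<close>.\<close>

definition tv_norm :: "'s set \<Rightarrow> ('s \<Rightarrow> real) \<Rightarrow> real" where
  "tv_norm I \<pi> = (\<Sum>i\<in>I. \<bar>\<pi> i\<bar>)"

end

theory Submission
  imports Defs
begin

text \<open>By the Markov property, \<open>P\<^sub>t\<^sub>,\<^sub>2\<^sub>t(i, j) = P\<^sub>t(i) p\<^sub>t(i, j)\<close> and
  \<open>P\<^sub>3\<^sub>t\<^sub>,\<^sub>2\<^sub>t(i, j) = P\<^sub>2\<^sub>t(j) p\<^sub>t(j, i)\<close>. Reversibility makes \<open>p\<^sub>t\<close> symmetric, so the likelihood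
  ratio is \<open>P\<^sub>t(i) / P\<^sub>2\<^sub>t(j)\<close> and the relative entropy splits into the two entropies. The bound
  follows from Pinsker's inequality for the joint laws, because the total variation distance
  does not increase under passing to the first marginal. Pinsker's inequality is obtained by
  applying Cauchy-Schwarz to \<open>(x - y)\<^sup>2 \<le> 2/3 (x + 2y) (x ln (x/y) - x + y)\<close>, where the two factors
  sum to \<open>2\<close> and to the relative entropy.\<close>

section \<open>Pinsker's inequality on a finite set\<close>

text \<open>The difference of the two sides vanishes at \<open>1\<close>, and its derivative has the
  sign of \<open>v - 1\<close>, so \<open>1\<close> is its minimum on the positive axis. With
  \<open>u = x / y\<close> it yields the pointwise bound behind Pinsker's inequality.\<close>

lemma ln_ge_rational:
  fixes u :: real
  assumes "0 < u"
  shows "1 - 1 / u + 3 * (u - 1)\<^sup>2 / (2 * (u\<^sup>2 + 2 * u)) \<le> ln u"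
proof -
  define g where "g = (\<lambda>u::real. ln u - 1 + 1 / u - 3 * (u - 1)\<^sup>2 / (2 * (u\<^sup>2 + 2 * u)))"
  have deriv: "(g has_real_derivative (v - 1) ^ 3 / (v\<^sup>2 * (v + 2)\<^sup>2)) (at v)" if "0 < v" for v
  proof -
    have factor: "v\<^sup>2 + 2 * v = v * (v + 2)"
      by (simp add: power2_eq_square algebra_simps)
    with that have nz: "v \<noteq> 0" "v + 2 \<noteq> 0" "v\<^sup>2 + 2 * v \<noteq> 0"
      by auto
    have "(g has_real_derivative 1 / v - 1 / v\<^sup>2
        - (6 * (v - 1) * (2 * (v\<^sup>2 + 2 * v)) - 3 * (v - 1)\<^sup>2 * (2 * (2 * v + 2)))
          / (2 * (v\<^sup>2 + 2 * v))\<^sup>2) (at v)"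
      unfolding g_def using that nz
      by (auto intro!: derivative_eq_intros simp: power2_eq_square)
    also have "1 / v - 1 / v\<^sup>2
        - (6 * (v - 1) * (2 * (v\<^sup>2 + 2 * v)) - 3 * (v - 1)\<^sup>2 * (2 * (2 * v + 2)))
          / (2 * (v\<^sup>2 + 2 * v))\<^sup>2 = (v - 1) ^ 3 / (v\<^sup>2 * (v + 2)\<^sup>2)"
      \<comment> \<open>The cube appears because
        \<open>(v + 2)^2 - 3 * (2 * v + 1) = (v - 1)^2\<close>.\<close>
      unfolding factor using nz(1,2) by (simp add: divide_simps) algebra
    finally show ?thesis .
  qed
  have "0 \<le> g u"
  proof (cases "u \<le> 1")
    case True
    have "g 1 \<le> g u"
    proof (rule DERIV_nonpos_imp_nonincreasing[OF True])
      fix v assume "u \<le> v" "v \<le> 1"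
      with assms have "0 < v" "(v - 1) ^ 3 / (v\<^sup>2 * (v + 2)\<^sup>2) \<le> 0"
        by (auto simp: divide_le_0_iff power3_eq_cube mult_le_0_iff zero_le_mult_iff)
      with deriv show "\<exists>y. (g has_real_derivative y) (at v) \<and> y \<le> 0" by blast
    qed
    then show ?thesis by (simp add: g_def)
  next
    case False
    then have "g 1 \<le> g u"
    proof (intro DERIV_nonneg_imp_nondecreasing[of 1 u g])
      fix v :: real assume "1 \<le> v" "v \<le> u"
      then have "0 < v" "0 \<le> (v - 1) ^ 3 / (v\<^sup>2 * (v + 2)\<^sup>2)" by auto
      with deriv show "\<exists>y. (g has_real_derivative y) (at v) \<and> 0 \<le> y" by blast
    qed simp
    then show ?thesis by (simp add: g_def)
  qed
  then show ?thesis by (simp add: g_def)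
qed

text \<open>The third assumption excludes \<open>x > 0\<close>, \<open>y = 0\<close>, where
  \<open>ln (x / 0) = 0\<close> would make the right side negative. For \<open>x = 0\<close> the
  claim reads \<open>y^2 <= 4/3 * y^2\<close>.\<close>

lemma square_diff_le_relative_entropy_term:
  fixes x y :: real
  assumes "0 \<le> x" "0 \<le> y" "y = 0 \<Longrightarrow> x = 0"
  shows "(x - y)\<^sup>2 \<le> 2 / 3 * (x + 2 * y) * (x * ln (x / y) - x + y)"
proof (cases "x = 0")
  case True
  then show ?thesis by (simp add: power2_eq_square)
next
  case False
  with assms have pos: "0 < x" "0 < y" by (auto simp: less_le)
  then have eqs: "x / y - 1 = (x - y) / y" "(x / y)\<^sup>2 + 2 * (x / y) = x * (x + 2 * y) / y\<^sup>2"
    and nz: "x + 2 * y > 0"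
    by (auto simp: field_simps power2_eq_square)
  have "1 - y / x + 3 * (x - y)\<^sup>2 / (2 * (x * (x + 2 * y))) \<le> ln (x / y)"
    using ln_ge_rational[of "x / y"] pos unfolding eqs by (simp add: power_divide)
  \<comment> \<open>The multiplier clears the denominators and turns the quadratic term into exactly
    \<open>(x - y)^2\<close>.\<close>
  then have "2 / 3 * (x + 2 * y) * x * (1 - y / x + 3 * (x - y)\<^sup>2 / (2 * (x * (x + 2 * y))))
      \<le> 2 / 3 * (x + 2 * y) * x * ln (x / y)"
    using pos by (intro mult_left_mono) auto
  moreover have "2 / 3 * (x + 2 * y) * x * (1 - y / x + 3 * (x - y)\<^sup>2 / (2 * (x * (x + 2 * y))))
      = 2 / 3 * (x + 2 * y) * (x - y) + (x - y)\<^sup>2"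
  proof -
    have "x \<noteq> 0" "x + 2 * y \<noteq> 0"
      using pos nz by auto
    then show ?thesis by (simp add: divide_simps) algebra
  qed
  ultimately have "2 / 3 * (x + 2 * y) * (x - y) + (x - y)\<^sup>2 \<le> 2 / 3 * (x + 2 * y) * x * ln (x / y)"
    by (simp only:)
  then show ?thesis by (simp add: field_simps)
qed

lemma pinsker_finite:
  fixes P Q :: "'b \<Rightarrow> real"
  assumes "\<And>i. i \<in> A \<Longrightarrow> 0 \<le> P i" "\<And>i. i \<in> A \<Longrightarrow> 0 \<le> Q i"
    and "\<And>i. i \<in> A \<Longrightarrow> Q i = 0 \<Longrightarrow> P i = 0"
    and "(\<Sum>i\<in>A. P i) = 1" "(\<Sum>i\<in>A. Q i) = 1"
  shows "(\<Sum>i\<in>A. \<bar>P i - Q i\<bar>) \<le> sqrt (2 * (\<Sum>i\<in>A. P i * ln (P i / Q i)))"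
proof -
  define c where "c i = 2 / 3 * (P i + 2 * Q i)" for i
  define d where "d i = P i * ln (P i / Q i) - P i + Q i" for i
  have sq: "(P i - Q i)\<^sup>2 \<le> c i * d i" if "i \<in> A" for i
    using square_diff_le_relative_entropy_term[of "P i" "Q i"] assms(1-3)[OF that]
    by (simp add: c_def d_def)
  have c: "0 \<le> c i" if "i \<in> A" for i
    using assms(1,2)[OF that] by (simp add: c_def)
  \<comment> \<open>Needed for the square roots. If \<open>c i > 0\<close>, it follows from
    \<open>sq\<close>, whose left side is a square; if \<open>c i = 0\<close>, both masses
    vanish.\<close>
  have d: "0 \<le> d i" if "i \<in> A" for i
  proof (cases "c i = 0")
    case True
    then have "P i = 0" "Q i = 0"
      using assms(1,2)[OF that] by (auto simp: c_def)
    then show ?thesis by (simp add: d_def)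
  next
    case False
    then show ?thesis
      using c[OF that] order_trans[OF zero_le_power2 sq[OF that]] by (simp add: zero_le_mult_iff)
  qed
  have "(\<Sum>i\<in>A. \<bar>P i - Q i\<bar>) \<le> (\<Sum>i\<in>A. sqrt (c i) * sqrt (d i))"
    using sq by (intro sum_mono) (metis real_sqrt_abs real_sqrt_le_mono real_sqrt_mult)
  then have "(\<Sum>i\<in>A. \<bar>P i - Q i\<bar>)\<^sup>2 \<le> (\<Sum>i\<in>A. sqrt (c i) * sqrt (d i))\<^sup>2"
    by (intro power_mono) (auto intro: sum_nonneg)
  also have "\<dots> \<le> (\<Sum>i\<in>A. (sqrt (c i))\<^sup>2) * (\<Sum>i\<in>A. (sqrt (d i))\<^sup>2)"
    by (rule Cauchy_Schwarz_ineq_sum)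
  also have "\<dots> = (\<Sum>i\<in>A. c i) * (\<Sum>i\<in>A. d i)"
    using c d by simp
  \<comment> \<open>The value is \<open>2/3 * (1 + 2 * 1)\<close>. In the sum of \<open>d\<close>,
    the linear terms cancel because both total masses are \<open>1\<close>.\<close>
  also have "(\<Sum>i\<in>A. c i) = 2"
    using assms(4,5) by (simp add: c_def sum.distrib flip: sum_distrib_left sum_divide_distrib)
  also have "(\<Sum>i\<in>A. d i) = (\<Sum>i\<in>A. P i * ln (P i / Q i))"
    using assms(4,5) by (simp add: d_def sum.distrib sum_subtractf)
  finally show ?thesis by (rule real_le_rsqrt)
qed

section \<open>Symmetry of the kernel and laws at one and two times\<close>

lemma reversible_uniform_symmetric:
  assumes "reversible_wrt I p (pmf_of_set I)" "finite I" "0 \<le> t" "i \<in> I" "j \<in> I"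
  shows "p t i j = p t j i"
proof -
  have "I \<noteq> {}" using assms by auto
  with assms show ?thesis by (auto simp: reversible_wrt_def card_gt_0_iff)
qed

context markov_chain
begin

lemma state_event:
  assumes "0 \<le> t" "i \<in> I"
  shows "{\<omega> \<in> space M. X t \<omega> = i} \<in> events"
  using measurable_sets[OF measurable_states[OF assms(1)], of "{i}"] assms
  by (auto simp: vimage_def Int_def conj_commute)

lemma measure_law:
  assumes "0 \<le> t" "i \<in> I"
  shows "measure (law M I X t) {i} = \<P>(\<omega> in M. X t \<omega> = i)"
  unfolding law_def using assms measurable_states[of t]
  by (subst measure_distr) (auto intro!: arg_cong[of _ _ prob])

text \<open>As \<open>I\<close> is finite, the product of the discrete sigma-algebras is discrete,
  so measurability of the two components suffices.\<close>

lemma measurable_joint: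
  assumes "0 \<le> u" "0 \<le> s"
  shows "(\<lambda>\<omega>. (X u \<omega>, X s \<omega>)) \<in> M \<rightarrow>\<^sub>M count_space (I \<times> I)"
proof -
  have "count_space (I \<times> I) = count_space I \<Otimes>\<^sub>M count_space I"
    by (simp add: pair_measure_count_space finite_states)
  then show ?thesis
    using measurable_states[OF assms(1)] measurable_states[OF assms(2)] by simp
qed

lemma measure_joint_law:
  assumes "0 \<le> u" "0 \<le> s" "i \<in> I" "j \<in> I"
  shows "measure (joint_law M I X u s) {(i, j)} = \<P>(\<omega> in M. X u \<omega> = i \<and> X s \<omega> = j)"
  unfolding joint_law_def using assms measurable_joint[of u s]
  by (subst measure_distr) (auto intro!: arg_cong[of _ _ prob])

text \<open>If the conditioning event is null, \<open>markov\<close> says nothing, but both sides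
  are then zero by monotonicity.\<close>

lemma prob_two_times:
  assumes "0 \<le> s" "s \<le> t" "i \<in> I" "j \<in> I"
  shows "\<P>(\<omega> in M. X t \<omega> = j \<and> X s \<omega> = i) = \<P>(\<omega> in M. X s \<omega> = i) * p (t - s) i j"
proof (cases "\<P>(\<omega> in M. X s \<omega> = i) = 0")
  case True
  have "{\<omega> \<in> space M. X s \<omega> = i} \<in> events"
    using assms by (intro state_event)
  then have "\<P>(\<omega> in M. X t \<omega> = j \<and> X s \<omega> = i) \<le> \<P>(\<omega> in M. X s \<omega> = i)"
    by (intro finite_measure_mono) auto
  with True show ?thesis by (simp add: measure_le_0_iff)
next
  case False
  then have "\<P>(\<omega> in M. X s \<omega> = i) > 0" by (simp add: zero_less_measure_iff)
  then have "\<P>(\<omega> in M. X t \<omega> = j \<bar> X s \<omega> = i) = p (t - s) i j"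
    \<comment> \<open>With \<open>m = 0\<close> the past consists of the single time
      \<open>s\<close>.\<close>
    using markov[of "\<lambda>_. s" 0 t "\<lambda>_. i" j] assms by (simp add: monotone_on_def)
  with False show ?thesis by (auto simp: cond_prob_def field_simps)
qed

text \<open>Intersecting with the almost sure event \<open>X 0 = a\<close> reduces the claim to the
  two times \<open>0\<close> and \<open>t\<close>.\<close>

lemma prob_from_start:
  assumes "AE \<omega> in M. X 0 \<omega> = a" "a \<in> I" "0 \<le> t" "j \<in> I"
  shows "\<P>(\<omega> in M. X t \<omega> = j) = p t a j"
proof -
  have "\<P>(\<omega> in M. X t \<omega> = j) = \<P>(\<omega> in M. X t \<omega> = j \<and> X 0 \<omega> = a)"
    using assms state_event[of t j] state_event[of 0 a]
    by (intro finite_measure_eq_AE) (auto simp: Collect_conj_eq2 conj_commute intro: sets.sets_Collect)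
  also have "\<dots> = \<P>(\<omega> in M. X 0 \<omega> = a) * p t a j"
    using prob_two_times[of 0 t a j] assms by simp
  also have "\<P>(\<omega> in M. X 0 \<omega> = a) = 1"
    using assms state_event[of 0 a] by (subst prob_Collect_eq_1) auto
  finally show ?thesis by simp
qed

end

section \<open>The entropy identity and the total variation bound\<close>

context transition_function
begin

text \<open>Row sums spread the first entropy, and Chapman-Kolmogorov the second, over the same
  joint weights \<open>p t a i * p t i j\<close>.\<close>

lemma entropy_difference_eq:
  assumes sym: "\<And>i j. i \<in> I \<Longrightarrow> j \<in> I \<Longrightarrow> p t i j = p t j i"
    and "0 \<le> t" "a \<in> I"
  shows "(\<Sum>i\<in>I. p t a i * ln (p t a i)) - (\<Sum>j\<in>I. p (2 * t) a j * ln (p (2 * t) a j))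
    = (\<Sum>(i, j)\<in>I \<times> I. p t a i * p t i j * (ln (p t a i) - ln (p (2 * t) a j)))"
proof -
  have "(\<Sum>i\<in>I. p t a i * ln (p t a i)) = (\<Sum>i\<in>I. \<Sum>j\<in>I. p t a i * p t i j * ln (p t a i))"
    using row_sum[OF assms(2)]
    by (simp flip: sum_distrib_left sum_distrib_right)
  moreover have "p (2 * t) a j = (\<Sum>i\<in>I. p t a i * p t i j)" if "j \<in> I" for j
    using chapman_kolmogorov[of t t a j] assms that by simp
  then have "(\<Sum>j\<in>I. p (2 * t) a j * ln (p (2 * t) a j))
      = (\<Sum>j\<in>I. \<Sum>i\<in>I. p t a i * p t i j * ln (p (2 * t) a j))"
    by (simp flip: sum_distrib_right)
  ultimately show ?thesis
    by (subst (asm) sum.swap) (simp add: sum.cartesian_product[symmetric] sum_subtractf right_diff_distrib)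
qed

end

lemma (in markov_chain) entropy_production:
  assumes sym: "\<And>t i j. 0 \<le> t \<Longrightarrow> i \<in> I \<Longrightarrow> j \<in> I \<Longrightarrow> p t i j = p t j i"
    and start: "AE \<omega> in M. X 0 \<omega> = a" "a \<in> I"
    and t: "0 \<le> t"
  shows "ereal (shannon_entropy (law M I X (2 * t)) - shannon_entropy (law M I X t))
      = relative_entropy (joint_law M I X t (2 * t)) (joint_law M I X (3 * t) (2 * t))"
    and "tv_norm I (\<lambda>i. measure (law M I X t) {i} - measure (law M I X (3 * t)) {i})
      \<le> sqrt (2 * (shannon_entropy (law M I X (2 * t)) - shannon_entropy (law M I X t)))"
proof -
  define P where "P = (\<lambda>(i, j). p t a i * p t i j)"
  \<comment> \<open>The step from time \<open>2 * t\<close> to \<open>3 * t\<close> goes from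
    \<open>j\<close> to \<open>i\<close>; symmetry rewrites its factor as \<open>p t i j\<close>,
    which then cancels in \<open>P / Q\<close>.\<close>
  define Q where "Q = (\<lambda>(i, j). p (2 * t) a j * p t i j)"
  have law: "measure (law M I X s) {i} = p s a i" if "0 \<le> s" "i \<in> I" for s i
    using that start by (simp add: measure_law prob_from_start)
  have P: "measure (joint_law M I X t (2 * t)) {x} = P x" if "x \<in> I \<times> I" for x
    using that t start prob_two_times[of t "2 * t"]
    by (auto simp: P_def measure_joint_law prob_from_start conj_commute)
  have Q: "measure (joint_law M I X (3 * t) (2 * t)) {x} = Q x" if "x \<in> I \<times> I" for x
    using that t start prob_two_times[of "2 * t" "3 * t"] sym
    by (auto simp: Q_def measure_joint_law prob_from_start)
  have ck2: "p (2 * t) a j = (\<Sum>i\<in>I. p t a i * p t i j)" if "j \<in> I" for j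
    using chapman_kolmogorov[of t t a j] that t start by simp
  have ck3: "p (3 * t) a i = (\<Sum>j\<in>I. p (2 * t) a j * p t i j)" if "i \<in> I" for i
    using chapman_kolmogorov[of "2 * t" t a i] that t start sym by simp
  have nonneg: "0 \<le> p s i j" if "0 \<le> s" "i \<in> I" "j \<in> I" for s i j
    using that by (rule transition_function.nonneg[OF transition_function_axioms])
  \<comment> \<open>\<open>p (2 * t) a j\<close> dominates the single Chapman-Kolmogorov summand
    through \<open>i\<close>, which is positive. Hence the infinite branch of
    \<open>relative_entropy\<close> is never reached, and the logarithm splits.\<close>
  have abs_cont: "0 < Q x \<and> ln (P x / Q x) = ln (p t a (fst x)) - ln (p (2 * t) a (snd x))"
    if x: "x \<in> I \<times> I" "P x \<noteq> 0" for x
  proof -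
    obtain i j where [simp]: "x = (i, j)" and ij: "i \<in> I" "j \<in> I" using x by auto
    have pos: "0 < p t a i" "0 < p t i j"
      using x(2) nonneg[OF t start(2) ij(1)] nonneg[OF t ij] by (auto simp: P_def less_le)
    have "p t a i * p t i j \<le> p (2 * t) a j"
      unfolding ck2[OF ij(2)] using ij nonneg t start
      by (intro member_le_sum[of i I "\<lambda>i. p t a i * p t i j"]) (auto simp: finite_states)
    with pos have "0 < p (2 * t) a j"
      by (meson less_le_trans mult_pos_pos)
    with pos show ?thesis by (simp add: P_def Q_def ln_div)
  qed
  have entropy: "shannon_entropy (law M I X (2 * t)) - shannon_entropy (law M I X t)
      = (\<Sum>x\<in>I \<times> I. P x * ln (P x / Q x))"
  proof -
    have "shannon_entropy (law M I X s) = - (\<Sum>i\<in>I. p s a i * ln (p s a i))" if "0 \<le> s" for s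
      using law[OF that] by (simp add: shannon_entropy_def) (simp add: law_def)
    then have "shannon_entropy (law M I X (2 * t)) - shannon_entropy (law M I X t)
        = (\<Sum>(i, j)\<in>I \<times> I. p t a i * p t i j * (ln (p t a i) - ln (p (2 * t) a j)))"
      using entropy_difference_eq[of t a] t start sym by simp
    also have "\<dots> = (\<Sum>x\<in>I \<times> I. P x * ln (P x / Q x))"
    proof (rule sum.cong[OF refl])
      fix x assume "x \<in> I \<times> I"
      then show "(case x of (i, j) \<Rightarrow> p t a i * p t i j * (ln (p t a i) - ln (p (2 * t) a j)))
          = P x * ln (P x / Q x)"
        using abs_cont[of x] by (cases "P x = 0") (auto simp: P_def split: prod.splits)
    qed
    finally show ?thesis .
  qed
  show "ereal (shannon_entropy (law M I X (2 * t)) - shannon_entropy (law M I X t))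
      = relative_entropy (joint_law M I X t (2 * t)) (joint_law M I X (3 * t) (2 * t))"
  proof -
    have "relative_entropy (joint_law M I X t (2 * t)) (joint_law M I X (3 * t) (2 * t))
        = (\<Sum>x\<in>I \<times> I. if P x = 0 then 0 else if Q x = 0 then \<infinity>
            else ereal (P x * ln (P x / Q x)))"
      unfolding relative_entropy_def by (rule sum.cong) (simp add: joint_law_def, simp add: P Q)
    also have "\<dots> = (\<Sum>x\<in>I \<times> I. ereal (P x * ln (P x / Q x)))"
    proof (rule sum.cong[OF refl])
      fix x assume "x \<in> I \<times> I"
      then show "(if P x = 0 then 0 else if Q x = 0 then \<infinity> else ereal (P x * ln (P x / Q x)))
          = ereal (P x * ln (P x / Q x))"
        using abs_cont[of x] by (cases "P x = 0") (simp_all add: zero_ereal_def less_le)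
    qed
    finally show ?thesis by (simp add: entropy)
  qed
  have row: "(\<Sum>j\<in>I. p s i j) = 1" if "0 \<le> s" "i \<in> I" for s i
    using that by (rule row_sum)
  have marg_P: "(\<Sum>j\<in>I. P (i, j)) = p t a i" if "i \<in> I" for i
    using row[OF t that] by (simp add: P_def flip: sum_distrib_left)
  have marg_Q: "(\<Sum>j\<in>I. Q (i, j)) = p (3 * t) a i" if "i \<in> I" for i
    using ck3[OF that] by (simp add: Q_def)
  have "tv_norm I (\<lambda>i. measure (law M I X t) {i} - measure (law M I X (3 * t)) {i})
      = (\<Sum>i\<in>I. \<bar>\<Sum>j\<in>I. P (i, j) - Q (i, j)\<bar>)"
    unfolding tv_norm_def using t by (intro sum.cong) (auto simp: law marg_P marg_Q sum_subtractf)
  also have "\<dots> \<le> (\<Sum>i\<in>I. \<Sum>j\<in>I. \<bar>P (i, j) - Q (i, j)\<bar>)"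
    by (intro sum_mono sum_abs)
  also have "\<dots> = (\<Sum>x\<in>I \<times> I. \<bar>P x - Q x\<bar>)"
    by (simp add: sum.cartesian_product)
  also have "\<dots> \<le> sqrt (2 * (\<Sum>x\<in>I \<times> I. P x * ln (P x / Q x)))"
  proof (rule pinsker_finite)
    show "0 \<le> P x" "0 \<le> Q x" if "x \<in> I \<times> I" for x
      using that t start nonneg by (auto simp: P_def Q_def)
    show "P x = 0" if "x \<in> I \<times> I" "Q x = 0" for x
      using abs_cont[OF that(1)] that(2) by (metis less_irrefl)
    \<comment> \<open>Summing out \<open>j\<close> leaves the rows \<open>p t a\<close> and
      \<open>p (3 * t) a\<close>, each of total mass \<open>1\<close>.\<close>
    have "sum P (I \<times> I) = (\<Sum>i\<in>I. \<Sum>j\<in>I. P (i, j))" "sum Q (I \<times> I) = (\<Sum>i\<in>I. \<Sum>j\<in>I. Q (i, j))"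
      by (simp_all add: sum.cartesian_product)
    then show "sum P (I \<times> I) = 1" "sum Q (I \<times> I) = 1"
      using t start by (simp_all add: marg_P marg_Q row)
  qed
  finally show "tv_norm I (\<lambda>i. measure (law M I X t) {i} - measure (law M I X (3 * t)) {i})
      \<le> sqrt (2 * (shannon_entropy (law M I X (2 * t)) - shannon_entropy (law M I X t)))"
    by (simp add: entropy)
qed

theorem lemma4:
  fixes n a :: nat
    and M :: "'w measure"
    and p :: "real \<Rightarrow> nat \<Rightarrow> nat \<Rightarrow> real"
    and X :: "real \<Rightarrow> 'w \<Rightarrow> nat"
  assumes "markov_chain M {1..n} p X"
    and "irreducible_chain {1..n} p"
    and "reversible_wrt {1..n} p (pmf_of_set {1..n})"
    and "a \<in> {1..n}"
    and "AE \<omega> in M. X 0 \<omega> = a"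
  shows "(\<forall>t\<ge>0.
            ereal (shannon_entropy (law M {1..n} X (2 * t)) - shannon_entropy (law M {1..n} X t))
              = relative_entropy (joint_law M {1..n} X t (2 * t))
                                 (joint_law M {1..n} X (3 * t) (2 * t)))
       \<and> (\<forall>t\<ge>0.
            tv_norm {1..n} (\<lambda>i. measure (law M {1..n} X t) {i} - measure (law M {1..n} X (3 * t)) {i})
              \<le> sqrt (2 * (shannon_entropy (law M {1..n} X (2 * t))
                            - shannon_entropy (law M {1..n} X t))))"
proof -
  interpret markov_chain M "{1..n}" p X by fact
  have "p t i j = p t j i" if "0 \<le> t" "i \<in> {1..n}" "j \<in> {1..n}" for t i j
    using assms(3) finite_states that by (rule reversible_uniform_symmetric)
  from entropy_production[OF this assms(5,4)] show ?thesis by blast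
qed

end
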